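(* Let $\mathcal{A}\in\mathcal{P}$ and let $\omega\preccurlyeq^{\mathcal{A}}\omega'$ be two cookie environments. Then there exists a probability space on which there are excited random walks $E_{\omega}$ and $E_{\omega'}$ in environments $\omega$ and $\omega'$ respectively, defined such that $E_{\omega}\preccurlyeq E_{\omega'}$ almost surely.
   Context: $\mathbb{N}=\{1,2,\dots\}$. Arrow systems. An arrow system is a collection $\mathcal{E}=(\mathcal{E}(x,r))_{x\in\mathbb{Z},r\in\mathbb{N}}$ with each $\mathcal{E}(x,r)\in\{\leftarrow,\rightarrow\}$; $\mathcal{E}_{\leftarrow}(j,r)$ is the number of $\leftarrow$ among $\mathcal{E}(j,1),\dots,\mathcal{E}(j,r)$. It determines an integer sequence $E=\{E_n\}_{n\ge 0}$: $E_0=0$ and, if $\#\{0\le m\le n: E_m=E_n\}=k$, then $E_{n+1}=E_n+1$ if $\mathcal{E}(E_n,k)=\rightarrow$ and $E_{n+1}=E_n-1$ if $\mathcal{E}(E_n,k)=\leftarrow$. For arrow systems, $\mathcal{L}\preccurlyeq\mathcal{R}$ means $\mathcal{L}_{\leftarrow}(j,r)\ge\mathcal{R}_{\leftarrow}(j,r)$ for all $j\in\mathbb{Z}$, $r\in\mathbb{N}$. For sequences, $L\preccurlyeq R$ means that there exist arrow systems $\mathcal{L}\preccurlyeq\mathcal{R}$ whose corresponding sequences are $L$ and $R$ respectively. Excited random walks. A cookie environment is an element $\omega=(\omega(x,n))_{x\in\mathbb{Z},n\in\mathbb{N}}$ of $[0,1]^{\mathbb{Z}\times\mathbb{N}}$.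 An excited random walk in environment $\omega$ (from the origin) is a sequence of random variables $X=\{X_n\}_{n\ge 0}$, adapted to a filtration $(\mathcal{F}_n)$, with $X_0=0$ a.s. and $P(X_{n+1}=X_n+1\mid\mathcal{F}_n)=\omega(X_n,\ell(n))=1-P(X_{n+1}=X_n-1\mid\mathcal{F}_n)$, where $\ell(n)=\sum_{m=0}^n 1_{\{X_m=X_n\}}$. Partitions. $\mathcal{P}$ is the set of all collections $\mathcal{A}=(\mathcal{A}_x)_{x\in\mathbb{Z}}$ where each $\mathcal{A}_x=(A_x^1,A_x^2,\dots)$ is an (ordered) partition of $\mathbb{N}$ into finite non-empty subsets. Write $\omega(x,A_x^s)=(\omega(x,r))_{r\in A_x^s}$. Favourable swaps. For $x\in\mathbb{Z}$, $s\in\mathbb{N}$ and $j\le k$ in $A_x^s$, the pair $b=(j,k)$ is an $(x,s,\omega)$-favourable swap if $\omega(x,j)\le\omega(x,k)$. The $A_x^s$-environment $\omega_b(x,A_x^s)$ produced by the swap is given by $\omega_b(x,j)=\omega(x,k)$, $\omega_b(x,k)=\omega(x,j)$, and $\omega_b(x,r)=\omega(x,r)$ for $r\in A_x^s\setminus\{j,k\}$. Permutations and order. $\omega'$ is an $\mathcal{A}$-permutation of $\omega$ if for every $x\in\mathbb{Z}$, $s\in\mathbb{N}$, $\omega'(x,A_x^s)$ is a permutation of $\omega(x,A_x^s)$. Write $\omega\preccurlyeq^{\mathcal{A}}\omega'$ if $\omega'$ is an $\mathcal{A}$-permutation of $\omega$ and, for every $x,s$, $\omega'(x,A_x^s)$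 can be obtained from $\omega(x,A_x^s)$ by a finite (possibly empty) sequence of swaps, each of which is favourable with respect to the $A_x^s$-environment to which it is applied. *)

theory Defs
  imports "HOL-Probability.Probability" "HOL-Combinatorics.Permutations"
begin

text \<open>
  The index set of arrows, cookies and blocks is \<open>{1, 2, \<dots>}\<close>. Families indexed by it are
  functions on \<open>nat\<close>; their value at index \<open>0\<close> is never used.
\<close>

section \<open>Arrow systems\<close>

datatype arrow = LeftArrow | RightArrow

type_synonym arrow_system = "int \<Rightarrow> nat \<Rightarrow> arrow"

definition left_arrows :: "arrow_system \<Rightarrow> int \<Rightarrow> nat \<Rightarrow> nat" where
  "left_arrows \<E> j r = card {i \<in> {1..r}. \<E> j i = LeftArrow}"

definition arrow_system_le :: "arrow_system \<Rightarrow> arrow_system \<Rightarrow> bool" where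
  "arrow_system_le \<L> \<R> \<longleftrightarrow> (\<forall>j. \<forall>r\<ge>1. left_arrows \<L> j r \<ge> left_arrows \<R> j r)"

definition visits :: "(nat \<Rightarrow> int) \<Rightarrow> nat \<Rightarrow> nat" where
  "visits S n = card {m. m \<le> n \<and> S m = S n}"

text \<open>
  The cardinality below is \<open>visits\<close> of the sequence itself, unfolded so that the recursion is
  seen to use earlier values only.
\<close>

context
  notes conj_cong [fundef_cong]
begin

fun arrow_walk :: "arrow_system \<Rightarrow> nat \<Rightarrow> int" where
  "arrow_walk \<E> 0 = 0"
| "arrow_walk \<E> (Suc n) = arrow_walk \<E> n +
     (if \<E> (arrow_walk \<E> n) (card {m. m \<le> n \<and> arrow_walk \<E> m = arrow_walk \<E> n}) = RightArrow
      then 1 else - 1)"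

end

lemma arrow_walk_Suc_visits:
  "arrow_walk \<E> (Suc n) = arrow_walk \<E> n +
     (if \<E> (arrow_walk \<E> n) (visits (arrow_walk \<E>) n) = RightArrow then 1 else - 1)"
  by (simp add: visits_def)

definition sequence_le :: "(nat \<Rightarrow> int) \<Rightarrow> (nat \<Rightarrow> int) \<Rightarrow> bool" where
  "sequence_le L R \<longleftrightarrow>
     (\<exists>\<L> \<R>. arrow_system_le \<L> \<R> \<and> L = arrow_walk \<L> \<and> R = arrow_walk \<R>)"

section \<open>Excited random walks\<close>

type_synonym environment = "int \<Rightarrow> nat \<Rightarrow> real"

definition cookie_environment :: "environment \<Rightarrow> bool" where
  "cookie_environment \<omega> \<longleftrightarrow> (\<forall>x. \<forall>n\<ge>1. 0 \<le> \<omega> x n \<and> \<omega> x n \<le> 1)"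

definition excited_random_walk ::
    "'a measure \<Rightarrow> environment \<Rightarrow> (nat \<Rightarrow> 'a \<Rightarrow> int) \<Rightarrow> bool" where
  "excited_random_walk M \<omega> X \<longleftrightarrow> prob_space M \<and>
     (\<exists>F :: nat \<Rightarrow> 'a measure.
        filtration (space M) F \<and> (\<forall>n. subalgebra M (F n)) \<and>
        (\<forall>n. X n \<in> F n \<rightarrow>\<^sub>M count_space UNIV) \<and>
        (AE u in M. X 0 u = 0) \<and>
        (\<forall>n. AE u in M.
           real_cond_exp M (F n) (indicator {v \<in> space M. X (Suc n) v = X n v + 1}) u
             = \<omega> (X n u) (visits (\<lambda>m. X m u) n)) \<and>
        (\<forall>n. AE u in M.
           1 - real_cond_exp M (F n) (indicator {v \<in> space M. X (Suc n) v = X n v - 1}) u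
             = \<omega> (X n u) (visits (\<lambda>m. X m u) n)))"

section \<open>Partitions and permutations of environments\<close>

text \<open>\<open>A x s\<close> is the \<open>s\<close>-th block of the ordered partition at site \<open>x\<close>.\<close>

type_synonym block_family = "int \<Rightarrow> nat \<Rightarrow> nat set"

definition partition_family :: "block_family \<Rightarrow> bool" where
  "partition_family A \<longleftrightarrow>
     (\<forall>x. (\<forall>s\<ge>1. finite (A x s) \<and> A x s \<noteq> {}) \<and>
          disjoint_family_on (A x) {1..} \<and> (\<Union>s\<in>{1..}. A x s) = {1..})"

text \<open>
  An environment on a block \<open>B\<close> is a function on \<open>B\<close>, i.e. an element of \<open>extensional B\<close>;
  \<open>favourable_swap B f g\<close> says that \<open>g\<close> arises from \<open>f\<close> by one favourable swap.
\<close>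

definition favourable_swap :: "nat set \<Rightarrow> (nat \<Rightarrow> real) \<Rightarrow> (nat \<Rightarrow> real) \<Rightarrow> bool" where
  "favourable_swap B f g \<longleftrightarrow>
     (\<exists>j\<in>B. \<exists>k\<in>B. j \<le> k \<and> f j \<le> f k \<and> g = f(j := f k, k := f j))"

definition block_permutation :: "block_family \<Rightarrow> environment \<Rightarrow> environment \<Rightarrow> bool" where
  "block_permutation A \<omega> \<omega>' \<longleftrightarrow>
     (\<forall>x. \<forall>s\<ge>1. \<exists>\<pi>. \<pi> permutes A x s \<and> (\<forall>r\<in>A x s. \<omega>' x r = \<omega> x (\<pi> r)))"

definition environment_le :: "block_family \<Rightarrow> environment \<Rightarrow> environment \<Rightarrow> bool" where
  "environment_le A \<omega> \<omega>' \<longleftrightarrow> block_permutation A \<omega> \<omega>' \<and>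
     (\<forall>x. \<forall>s\<ge>1. (favourable_swap (A x s))\<^sup>*\<^sup>*
        (restrict (\<omega> x) (A x s)) (restrict (\<omega>' x) (A x s)))"

end

theory Submission
  imports Defs
begin

text \<open>
  An excited random walk is obtained by drawing all arrows beforehand, independently, the arrow
  \<open>(x, r)\<close> pointing right with probability \<open>\<omega> x r\<close>, and then following them: the walk
  uses each arrow at most once, so given its past the next arrow is still fresh
  (\<open>excited_random_walk_arrow_walk\<close>). It therefore suffices to construct two coupled arrow
  systems, one with the law given by \<open>\<omega>\<close> and one with the law given by \<open>\<omega>'\<close>, such that the
  first lies below the second almost surely. The comparison of the walks is then immediate, since
  \<open>sequence_le\<close> asks for nothing but comparable arrow systems that generate them.

  The arrow systems can be coupled one block at a time. Number the arrows of a finite block in their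
  order of use, and consider one favourable swap, moving the larger of two probabilities
  \<open>p \<le> q\<close> from the later position \<open>k\<close> to the earlier position \<open>j\<close>. The arrow with probability \<open>q\<close>
  is a mixture: either it surely points right, or it has probability \<open>p\<close> like the other one. In
  the second case the two positions have the same law before and after the swap, and the pair is kept.
  In the first case the sure arrow moves from \<open>k\<close> to \<open>j\<close> and the other arrow from \<open>j\<close> to \<open>k\<close>; a left
  arrow can only move to a later position, so no initial segment gains left arrows
  (\<open>rel_pmf_favourable_pair\<close>, \<open>rel_pmf_favourable_swap\<close>). Couplings along a finite sequence of
  swaps compose, because the comparison of left-arrow counts is transitive
  (\<open>rel_pmf_favourable_swaps\<close>).

  Taking the couplings of different blocks independent of each other makes all arrows of each
  system independent (\<open>independent_arrows_glue\<close>), and the number of left arrows among the first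
  \<open>m\<close> at a site is the sum over the blocks of the left arrows with index at most \<open>m\<close>, so the
  comparison passes from the blocks to the arrow systems (\<open>arrow_system_le_glue\<close>).
\<close>

section \<open>Paths of arrow systems\<close>

text \<open>
  The path up to time \<open>n\<close>, frozen from then on. This keeps finite histories in the type of
  sequences, so that \<open>visits\<close> applies to them and shorter histories are functions of longer ones.
\<close>

definition stopped_path :: "nat \<Rightarrow> (nat \<Rightarrow> int) \<Rightarrow> nat \<Rightarrow> int" where
  "stopped_path n S = (\<lambda>m. S (min m n))"

lemma stopped_path_eq_iff: "stopped_path n S = stopped_path n S' \<longleftrightarrow> (\<forall>m\<le>n. S m = S' m)"
proof
  assume eq: "stopped_path n S = stopped_path n S'"
  show "\<forall>m\<le>n. S m = S' m"
  proof (intro allI impI)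
    fix m assume "m \<le> n"
    then show "S m = S' m" using fun_cong[OF eq, of m] by (simp add: stopped_path_def)
  qed
qed (auto simp: stopped_path_def)

lemma stopped_path_stopped_path:
  "m \<le> n \<Longrightarrow> stopped_path m (stopped_path n S) = stopped_path m S"
  by (simp add: stopped_path_def fun_eq_iff min_def)

lemma visits_cong: "(\<And>m. m \<le> n \<Longrightarrow> S m = S' m) \<Longrightarrow> visits S n = visits S' n"
  unfolding visits_def by (rule arg_cong[of _ _ card]) auto

lemma visits_stopped_path [simp]: "visits (stopped_path n S) n = visits S n"
  by (rule visits_cong) (simp add: stopped_path_def)

lemma stopped_path_apply_self [simp]: "stopped_path n S n = S n"
  by (simp add: stopped_path_def)

lemma visits_pos: "1 \<le> visits S n"
proof -
  have "card {n} \<le> card {m. m \<le> n \<and> S m = S n}" by (rule card_mono) auto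
  then show ?thesis by (simp add: visits_def)
qed

lemma visits_strict_mono:
  assumes "m < n" "S m = S n"
  shows "visits S m < visits S n"
  unfolding visits_def
  by (rule psubset_card_mono) (use assms in \<open>auto simp: psubset_eq set_eq_iff intro: exI[of _ n]\<close>)

text \<open>
  No arrow is used twice: each return to a site raises the visit count.
\<close>

lemma inj_arrow_used: "inj (\<lambda>m. (S m, visits S m))"
proof (rule injI)
  fix m n assume "(S m, visits S m) = (S n, visits S n)"
  then show "m = n"
    using visits_strict_mono[of m n S] visits_strict_mono[of n m S] by (cases m n rule: linorder_cases) auto
qed

text \<open>
  This turns an event about the path into an event about finitely many specified arrows, whose
  probability is known when the arrows are independent.
\<close>

lemma stopped_arrow_walk_eq_iff:
  "stopped_path n (arrow_walk \<E>) = stopped_path n (arrow_walk \<A>) \<longleftrightarrow>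
    (\<forall>m<n. \<E> (arrow_walk \<A> m) (visits (arrow_walk \<A>) m)
         = \<A> (arrow_walk \<A> m) (visits (arrow_walk \<A>) m))"
  unfolding stopped_path_eq_iff
proof (induction n)
  case (Suc n)
  have "(\<forall>m\<le>Suc n. arrow_walk \<E> m = arrow_walk \<A> m) \<longleftrightarrow>
     (\<forall>m\<le>n. arrow_walk \<E> m = arrow_walk \<A> m) \<and> arrow_walk \<E> (Suc n) = arrow_walk \<A> (Suc n)"
    by (auto simp: le_Suc_eq)
  also have "\<dots> \<longleftrightarrow> (\<forall>m\<le>n. arrow_walk \<E> m = arrow_walk \<A> m) \<and>
     \<E> (arrow_walk \<A> n) (visits (arrow_walk \<A>) n) = \<A> (arrow_walk \<A> n) (visits (arrow_walk \<A>) n)"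
  proof (intro conj_cong refl)
    assume eq: "\<forall>m\<le>n. arrow_walk \<E> m = arrow_walk \<A> m"
    have v: "visits (arrow_walk \<E>) n = visits (arrow_walk \<A>) n"
      by (rule visits_cong) (simp add: eq)
    have n: "arrow_walk \<E> n = arrow_walk \<A> n" using eq by simp
    show "arrow_walk \<E> (Suc n) = arrow_walk \<A> (Suc n) \<longleftrightarrow>
      \<E> (arrow_walk \<A> n) (visits (arrow_walk \<A>) n) = \<A> (arrow_walk \<A> n) (visits (arrow_walk \<A>) n)"
      unfolding arrow_walk_Suc_visits v n
      by (cases "\<E> (arrow_walk \<A> n) (visits (arrow_walk \<A>) n)";
          cases "\<A> (arrow_walk \<A> n) (visits (arrow_walk \<A>) n)") simp_all
  qed
  also have "\<dots> \<longleftrightarrow> (\<forall>m<Suc n. \<E> (arrow_walk \<A> m) (visits (arrow_walk \<A>) m)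
         = \<A> (arrow_walk \<A> m) (visits (arrow_walk \<A>) m))"
    unfolding Suc.IH by (auto simp: less_Suc_eq)
  finally show ?case .
qed simp

text \<open>
  Finiteness lets conditioning on the past reduce to conditioning on single paths.
\<close>

lemma finite_stopped_arrow_walks: "finite (range (\<lambda>\<E>. stopped_path n (arrow_walk \<E>)))"
proof (induction n)
  case 0
  have "range (\<lambda>\<E>. stopped_path 0 (arrow_walk \<E>)) \<subseteq> {\<lambda>_. 0}"
    by (auto simp: stopped_path_def)
  then show ?case by (rule finite_subset) simp
next
  case (Suc n)
  let ?ext = "\<lambda>(S, d::int). (\<lambda>m. if m \<le> n then S m else S n + d)"
  have "range (\<lambda>\<E>. stopped_path (Suc n) (arrow_walk \<E>))
    \<subseteq> ?ext ` (range (\<lambda>\<E>. stopped_path n (arrow_walk \<E>)) \<times> {1, -1})"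
  proof (rule image_subsetI)
    fix \<E>
    have "stopped_path (Suc n) (arrow_walk \<E>)
      = ?ext (stopped_path n (arrow_walk \<E>), arrow_walk \<E> (Suc n) - arrow_walk \<E> n)"
      by (auto simp: stopped_path_def fun_eq_iff min_def le_Suc_eq not_le)
    moreover have "arrow_walk \<E> (Suc n) - arrow_walk \<E> n \<in> {1, -1}"
      unfolding arrow_walk_Suc_visits by simp
    ultimately show "stopped_path (Suc n) (arrow_walk \<E>)
      \<in> ?ext ` (range (\<lambda>\<E>. stopped_path n (arrow_walk \<E>)) \<times> {1, -1})" by blast
  qed
  then show ?case by (rule finite_subset) (simp add: Suc.IH)
qed

section \<open>Independent arrows drive an excited random walk\<close>

definition arrow_pmf :: "real \<Rightarrow> arrow pmf" where
  "arrow_pmf p = map_pmf (\<lambda>b. if b then RightArrow else LeftArrow) (bernoulli_pmf p)"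

lemma pmf_arrow_pmf:
  assumes "0 \<le> p" "p \<le> 1"
  shows "pmf (arrow_pmf p) RightArrow = p" "pmf (arrow_pmf p) LeftArrow = 1 - p"
proof -
  have "pmf (arrow_pmf p) (if b then RightArrow else LeftArrow) = pmf (bernoulli_pmf p) b" for b
    unfolding arrow_pmf_def by (rule pmf_map_inj') (auto intro!: injI split: if_splits)
  from this[of True] this[of False] assms
  show "pmf (arrow_pmf p) RightArrow = p" "pmf (arrow_pmf p) LeftArrow = 1 - p" by simp_all
qed

text \<open>
  Independence together with the marginal laws, expressed as the product formula for prescribing
  finitely many arrows. Arrows of index \<open>0\<close> are excluded, as they belong to no environment.
\<close>

definition independent_arrows ::
    "'a measure \<Rightarrow> environment \<Rightarrow> ('a \<Rightarrow> arrow_system) \<Rightarrow> bool" where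
  "independent_arrows M \<omega> a \<longleftrightarrow>
     (\<forall>x r. (\<lambda>u. a u x r) \<in> M \<rightarrow>\<^sub>M count_space UNIV) \<and>
     (\<forall>J \<A>. finite J \<longrightarrow> J \<subseteq> UNIV \<times> {1..} \<longrightarrow>
        measure M {u \<in> space M. \<forall>(x, r)\<in>J. a u x r = \<A> x r}
          = (\<Prod>(x, r)\<in>J. pmf (arrow_pmf (\<omega> x r)) (\<A> x r)))"

lemma independent_arrows_distr:
  assumes T: "T \<in> M \<rightarrow>\<^sub>M N"
    and a: "\<And>x r. (\<lambda>u. a u x r) \<in> N \<rightarrow>\<^sub>M count_space UNIV"
    and ind: "independent_arrows M \<omega> (\<lambda>u. a (T u))"
  shows "independent_arrows (distr M N T) \<omega> a"
  unfolding independent_arrows_def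
proof (intro conjI allI impI)
  fix J :: "(int \<times> nat) set" and \<A> assume J: "finite J" "J \<subseteq> UNIV \<times> {1..}"
  note a[measurable]
  have [measurable]: "{u \<in> space N. \<forall>(x, r)\<in>J. a u x r = \<A> x r} \<in> sets N"
    using J(1) by (simp add: case_prod_unfold)
  have "measure (distr M N T) {u \<in> space N. \<forall>(x, r)\<in>J. a u x r = \<A> x r}
    = measure M {u \<in> space M. \<forall>(x, r)\<in>J. a (T u) x r = \<A> x r}"
    by (subst measure_distr[OF T]) (auto intro!: arg_cong[of _ _ "measure M"] dest: measurable_space[OF T])
  also have "\<dots> = (\<Prod>(x, r)\<in>J. pmf (arrow_pmf (\<omega> x r)) (\<A> x r))"
    using ind J unfolding independent_arrows_def by blast
  finally show "measure (distr M N T) {u \<in> space (distr M N T). \<forall>(x, r)\<in>J. a u x r = \<A> x r}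
    = (\<Prod>(x, r)\<in>J. pmf (arrow_pmf (\<omega> x r)) (\<A> x r))" by simp
qed (use a in simp)

lemma sets_stopped_arrow_walk:
  assumes "independent_arrows M \<omega> a"
  shows "{u \<in> space M. stopped_path n (arrow_walk (a u)) = stopped_path n (arrow_walk \<A>)} \<in> sets M"
proof -
  have [measurable]: "(\<lambda>u. a u x r) \<in> M \<rightarrow>\<^sub>M count_space UNIV" for x r
    using assms by (simp add: independent_arrows_def)
  show ?thesis unfolding stopped_arrow_walk_eq_iff by measurable
qed

lemma measurable_stopped_arrow_walk:
  assumes "independent_arrows M \<omega> a"
  shows "(\<lambda>u. stopped_path n (arrow_walk (a u))) \<in> M \<rightarrow>\<^sub>M count_space UNIV"
proof -
  let ?R = "range (\<lambda>\<E>. stopped_path n (arrow_walk \<E>))"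
  have "(\<lambda>u. stopped_path n (arrow_walk (a u))) \<in> M \<rightarrow>\<^sub>M count_space ?R"
    unfolding measurable_count_space_eq2[OF finite_stopped_arrow_walks]
  proof (intro conjI ballI)
    fix S assume "S \<in> ?R"
    then obtain \<A> where S: "S = stopped_path n (arrow_walk \<A>)" by blast
    have "(\<lambda>u. stopped_path n (arrow_walk (a u))) -` {S} \<inter> space M
       = {u \<in> space M. stopped_path n (arrow_walk (a u)) = stopped_path n (arrow_walk \<A>)}"
      by (auto simp: S)
    then show "(\<lambda>u. stopped_path n (arrow_walk (a u))) -` {S} \<inter> space M \<in> sets M"
      using sets_stopped_arrow_walk[OF assms] by simp
  qed auto
  from measurable_compose[OF this, of "\<lambda>S. S" "count_space UNIV"] show ?thesis by simp
qed

text \<open>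
  The history fixes the arrows at \<open>(W m, visits W m)\<close> for \<open>m < n\<close>, and the next step reads the arrow
  with \<open>m = n\<close>. By \<open>inj_arrow_used\<close> the latter is a new one, so it contributes one
  further factor to the product formula.
\<close>

lemma measure_path_and_next_arrow:
  fixes \<A> :: arrow_system and n :: nat and a :: "'a \<Rightarrow> arrow_system"
  defines "W \<equiv> arrow_walk \<A>"
  assumes ind: "independent_arrows M \<omega> a"
  shows "measure M {u \<in> space M. stopped_path n (arrow_walk (a u)) = stopped_path n W \<and>
             a u (W n) (visits W n) = c}
       = pmf (arrow_pmf (\<omega> (W n) (visits W n))) c *
         measure M {u \<in> space M. stopped_path n (arrow_walk (a u)) = stopped_path n W}"
proof -
  let ?f = "\<lambda>m. (W m, visits W m)"
  let ?J = "?f ` {..<n}"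
  \<comment> \<open>The product formula prescribes arrows by one arrow system; \<open>?B\<close> demands \<open>c\<close> at the next arrow.\<close>
  let ?B = "\<A>(W n := (\<A> (W n))(visits W n := c))"
  have notin: "?f n \<notin> ?J"
    using inj_arrow_used[of W] by (auto dest: injD)
  have sub: "insert (?f n) ?J \<subseteq> UNIV \<times> {1..}"
    using visits_pos[of W] by auto
  have B: "?B x r = \<A> x r" if "(x, r) \<in> ?J" for x r
  proof -
    have "(x, r) \<noteq> ?f n" using that notin by metis
    then show ?thesis by auto
  qed
  have meas: "measure M {u \<in> space M. \<forall>(x, r)\<in>K. a u x r = \<C> x r}
      = (\<Prod>(x, r)\<in>K. pmf (arrow_pmf (\<omega> x r)) (\<C> x r))"
    if "finite K" "K \<subseteq> UNIV \<times> {1..}" for K \<C>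
    using ind that unfolding independent_arrows_def by blast
  have path: "stopped_path n (arrow_walk (a u)) = stopped_path n W
      \<longleftrightarrow> (\<forall>(x, r)\<in>?J. a u x r = \<A> x r)" for u
    unfolding W_def stopped_arrow_walk_eq_iff by auto
  have path_next: "stopped_path n (arrow_walk (a u)) = stopped_path n W \<and>
        a u (W n) (visits W n) = c
      \<longleftrightarrow> (\<forall>(x, r)\<in>insert (?f n) ?J. a u x r = ?B x r)" for u
    unfolding path using B by (auto simp del: fun_upd_apply) (auto simp: fun_upd_def)
  have "measure M {u \<in> space M. stopped_path n (arrow_walk (a u)) = stopped_path n W \<and>
             a u (W n) (visits W n) = c}
     = (\<Prod>(x, r)\<in>insert (?f n) ?J. pmf (arrow_pmf (\<omega> x r)) (?B x r))"
    unfolding path_next using sub by (intro meas) auto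
  also have "\<dots> = pmf (arrow_pmf (\<omega> (W n) (visits W n))) c *
      (\<Prod>(x, r)\<in>?J. pmf (arrow_pmf (\<omega> x r)) (?B x r))"
    using notin by (subst prod.insert) auto
  also have "(\<Prod>(x, r)\<in>?J. pmf (arrow_pmf (\<omega> x r)) (?B x r))
      = (\<Prod>(x, r)\<in>?J. pmf (arrow_pmf (\<omega> x r)) (\<A> x r))"
    using B by (intro prod.cong refl) (auto simp del: fun_upd_apply)
  also have "\<dots> = measure M {u \<in> space M. stopped_path n (arrow_walk (a u)) = stopped_path n W}"
    unfolding path using sub by (intro meas[symmetric]) auto
  finally show ?thesis .
qed

text \<open>
  The natural filtration of the walk.
\<close>

definition path_algebra :: "'a measure \<Rightarrow> ('a \<Rightarrow> arrow_system) \<Rightarrow> nat \<Rightarrow> 'a measure" where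
  "path_algebra M a n =
     vimage_algebra (space M) (\<lambda>u. stopped_path n (arrow_walk (a u))) (count_space UNIV)"

lemma space_path_algebra [simp]: "space (path_algebra M a n) = space M"
  by (simp add: path_algebra_def)

lemma stopped_path_measurable_path_algebra:
  assumes "m \<le> n"
  shows "(\<lambda>u. g (stopped_path m (arrow_walk (a u)))) \<in> path_algebra M a n \<rightarrow>\<^sub>M count_space UNIV"
proof -
  have "(\<lambda>u. stopped_path n (arrow_walk (a u))) \<in> path_algebra M a n \<rightarrow>\<^sub>M count_space UNIV"
    unfolding path_algebra_def by (rule measurable_vimage_algebra1) simp
  from measurable_compose[OF this, of "\<lambda>S. g (stopped_path m S)" "count_space UNIV"] assms
  show ?thesis by (simp add: stopped_path_stopped_path)
qed

lemma sets_path_algebra: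
  "sets (path_algebra M a n) =
     {(\<lambda>u. stopped_path n (arrow_walk (a u))) -` \<S> \<inter> space M | \<S>. True}"
  unfolding path_algebra_def by (subst sets_vimage_algebra2) auto

lemma filtration_path_algebra: "filtration (space M) (path_algebra M a)"
proof
  fix m n :: nat assume "m \<le> n"
  show "sets (path_algebra M a m) \<subseteq> sets (path_algebra M a n)"
    using measurable_sets[OF stopped_path_measurable_path_algebra[OF \<open>m \<le> n\<close>, of "\<lambda>S. S" a M]]
    unfolding sets_path_algebra[of M a m] by auto
qed simp

lemma subalgebra_path_algebra:
  assumes "independent_arrows M \<omega> a"
  shows "subalgebra M (path_algebra M a n)"
  unfolding subalgebra_def sets_path_algebra
  using measurable_sets[OF measurable_stopped_arrow_walk[OF assms, of n]] by auto

text \<open>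
  Every event of the past is a finite disjoint union of atoms, one for each possible path up to time
  \<open>n\<close>. On an atom the conditional probability is constant, and its defining integral
  identity is \<open>measure_path_and_next_arrow\<close>.
\<close>

lemma cond_exp_next_arrow:
  assumes "prob_space M" and ind: "independent_arrows M \<omega> a"
  shows "AE u in M. real_cond_exp M (path_algebra M a n)
       (indicator {v \<in> space M. a v (arrow_walk (a v) n) (visits (arrow_walk (a v)) n) = c}) u
     = pmf (arrow_pmf (\<omega> (arrow_walk (a u) n) (visits (arrow_walk (a u)) n))) c"
proof -
  interpret prob_space M by fact
  let ?F = "path_algebra M a n"
  let ?G = "\<lambda>u. stopped_path n (arrow_walk (a u))"
  let ?N = "{v \<in> space M. a v (arrow_walk (a v) n) (visits (arrow_walk (a v)) n) = c}"
  let ?g = "\<lambda>u. pmf (arrow_pmf (\<omega> (arrow_walk (a u) n) (visits (arrow_walk (a u)) n))) c"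
  interpret F: finite_measure_subalgebra M ?F
    by unfold_locales (rule subalgebra_path_algebra[OF ind])
  note G = measurable_stopped_arrow_walk[OF ind, of n]
  have [measurable]: "(\<lambda>u. a u x r) \<in> M \<rightarrow>\<^sub>M count_space UNIV" for x r
    using ind by (simp add: independent_arrows_def)
  have now: "arrow_walk (a u) n = ?G u n \<and> visits (arrow_walk (a u)) n = visits (?G u) n" for u
    by simp
  have gF: "?g \<in> borel_measurable ?F"
    using measurable_compose[OF stopped_path_measurable_path_algebra[OF order_refl,
      of "\<lambda>S. pmf (arrow_pmf (\<omega> (S n) (visits S n))) c" n a M], of "\<lambda>x. x" borel]
    by simp
  have gM: "?g \<in> borel_measurable M"
    by (rule measurable_from_subalg[OF F.subalg gF])
  have g_int: "integrable M ?g"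
    by (rule integrable_const_bound[of _ 1]) (use gM in \<open>auto simp: pmf_le_1\<close>)
  have atom: "?G -` {?G v} \<inter> space M = {u \<in> space M. ?G u = ?G v}" for v
    by auto
  have atom_sets: "?G -` {S} \<inter> space M \<in> sets M" for S
    using G by (rule measurable_sets) simp
  have same: "arrow_walk (a u) n = arrow_walk (a v) n \<and>
      visits (arrow_walk (a u)) n = visits (arrow_walk (a v)) n" if "?G u = ?G v" for u v
    using that by (metis now)
  let ?R = "?G ` space M"
  have finR: "finite ?R"
    by (rule finite_subset[OF _ finite_stopped_arrow_walks[of n]]) auto
  have N_atom: "?N \<inter> (?G -` {?G v} \<inter> space M)
       = {u \<in> space M. ?G u = ?G v \<and> a u (arrow_walk (a v) n) (visits (arrow_walk (a v)) n) = c}" for v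
  proof (rule set_eqI)
    fix u
    show "u \<in> ?N \<inter> (?G -` {?G v} \<inter> space M) \<longleftrightarrow> u \<in> {u \<in> space M. ?G u = ?G v \<and>
        a u (arrow_walk (a v) n) (visits (arrow_walk (a v)) n) = c}"
    proof (cases "?G u = ?G v")
      case True
      from same[OF True] True show ?thesis by auto
    qed simp
  qed
  have N_atom_sets: "?N \<inter> (?G -` {?G v} \<inter> space M) \<in> sets M" for v
    unfolding N_atom using sets_stopped_arrow_walk[OF ind, of n "a v"] by measurable
  have "?N = (\<Union>S\<in>?R. ?N \<inter> (?G -` {S} \<inter> space M))" by auto
  also have "\<dots> \<in> sets M"
    using finR N_atom_sets by (intro sets.finite_UN) auto
  finally have N_sets: "?N \<in> sets M" .
  have N_int: "integrable M (indicator ?N :: _ \<Rightarrow> real)"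
    using N_sets by (simp add: integrable_indicator_iff emeasure_eq_measure)
  have atom_eq: "(LINT u:?G -` {S} \<inter> space M|M. indicator ?N u) = (LINT u:?G -` {S} \<inter> space M|M. ?g u)"
    if S: "S \<in> ?R" for S
  proof -
    obtain v where v: "v \<in> space M" "S = ?G v" using S by blast
    have "(LINT u:?G -` {S} \<inter> space M|M. indicator ?N u) = measure M (?N \<inter> (?G -` {S} \<inter> space M))"
      using N_atom_sets[of v] N_sets atom_sets[of S]
      by (simp add: set_lebesgue_integral_def v(2) flip: indicator_inter_arith)
        (simp add: Int_commute Int_assoc Int_left_commute)
    also have "\<dots> = ?g v * measure M (?G -` {S} \<inter> space M)"
      unfolding v(2) unfolding N_atom unfolding atom by (rule measure_path_and_next_arrow[OF ind])
    also have "\<dots> = (LINT u:?G -` {S} \<inter> space M|M. ?g v)"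
      using atom_sets[of S] by (simp add: set_lebesgue_integral_def)
    also have "\<dots> = (LINT u:?G -` {S} \<inter> space M|M. ?g u)"
    proof (rule set_lebesgue_integral_cong[OF atom_sets], intro allI impI)
      fix u assume "u \<in> ?G -` {S} \<inter> space M"
      then have "?G u = ?G v" by (simp add: v(2))
      from same[OF this] show "?g v = ?g u" by simp
    qed
    finally show ?thesis .
  qed
  show ?thesis
  proof (rule F.real_cond_exp_charact[OF _ N_int g_int gF])
    fix A assume "A \<in> sets ?F"
    then obtain \<S> where A: "A = ?G -` \<S> \<inter> space M" unfolding sets_path_algebra by blast
    let ?I = "\<S> \<inter> ?R"
    have A_Union: "A = (\<Union>S\<in>?I. ?G -` {S} \<inter> space M)" unfolding A by auto
    have split: "(LINT u:A|M. f u) = (\<Sum>S\<in>?I. LINT u:?G -` {S} \<inter> space M|M. f u)"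
      if "integrable M f" for f :: "'a \<Rightarrow> real"
      unfolding A_Union
    proof (rule set_integral_finite_Union)
      show "finite ?I" using finR by simp
      show "disjoint_family_on (\<lambda>S. ?G -` {S} \<inter> space M) ?I" by (auto simp: disjoint_family_on_def)
      show "set_integrable M (?G -` {S} \<inter> space M) f" for S
        unfolding set_integrable_def using integrable_mult_indicator[OF atom_sets that] .
    qed (rule atom_sets)
    show "(LINT u:A|M. indicator ?N u) = (LINT u:A|M. ?g u)"
      unfolding split[OF N_int] split[OF g_int] by (rule sum.cong) (simp_all add: atom_eq)
  qed
qed

lemma excited_random_walk_arrow_walk:
  assumes M: "prob_space M" and \<omega>: "cookie_environment \<omega>" and ind: "independent_arrows M \<omega> a"
  shows "excited_random_walk M \<omega> (\<lambda>n u. arrow_walk (a u) n)"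
  unfolding excited_random_walk_def
proof (intro conjI exI[of _ "path_algebra M a"] allI)
  fix n
  have range: "0 \<le> \<omega> x (visits S n)" "\<omega> x (visits S n) \<le> 1" for x S
    using \<omega> visits_pos[of S n] by (auto simp: cookie_environment_def)
  have step: "arrow_walk \<E> (Suc n) = arrow_walk \<E> n + 1 \<longleftrightarrow>
       \<E> (arrow_walk \<E> n) (visits (arrow_walk \<E>) n) = RightArrow"
    "arrow_walk \<E> (Suc n) = arrow_walk \<E> n - 1 \<longleftrightarrow>
       \<E> (arrow_walk \<E> n) (visits (arrow_walk \<E>) n) = LeftArrow" for \<E>
    unfolding arrow_walk_Suc_visits
    by (cases "\<E> (arrow_walk \<E> n) (visits (arrow_walk \<E>) n)"; simp)+
  show "(\<lambda>u. arrow_walk (a u) n) \<in> path_algebra M a n \<rightarrow>\<^sub>M count_space UNIV"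
    using stopped_path_measurable_path_algebra[OF order_refl, of "\<lambda>S. S n" n a M]
    by (simp add: stopped_path_def)
  show "AE u in M. real_cond_exp M (path_algebra M a n)
      (indicator {v \<in> space M. arrow_walk (a v) (Suc n) = arrow_walk (a v) n + 1}) u
    = \<omega> (arrow_walk (a u) n) (visits (\<lambda>m. arrow_walk (a u) m) n)"
    unfolding step using cond_exp_next_arrow[OF M ind, of n RightArrow]
    by (simp add: pmf_arrow_pmf range)
  show "AE u in M. 1 - real_cond_exp M (path_algebra M a n)
      (indicator {v \<in> space M. arrow_walk (a v) (Suc n) = arrow_walk (a v) n - 1}) u
    = \<omega> (arrow_walk (a u) n) (visits (\<lambda>m. arrow_walk (a u) m) n)"
    unfolding step using cond_exp_next_arrow[OF M ind, of n LeftArrow]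
    by (auto simp: pmf_arrow_pmf range elim!: eventually_mono)
qed (use M filtration_path_algebra subalgebra_path_algebra[OF ind] in auto)

section \<open>Coupling the arrows of one block\<close>

definition block_pmf :: "nat set \<Rightarrow> (nat \<Rightarrow> real) \<Rightarrow> (nat \<Rightarrow> arrow) pmf" where
  "block_pmf B f = Pi_pmf B LeftArrow (\<lambda>r. arrow_pmf (f r))"

lemma block_pmf_restrict: "block_pmf B (restrict f B) = block_pmf B f"
  unfolding block_pmf_def by (rule Pi_pmf_cong) auto

text \<open>
  The order of arrow systems restricted to one block: an initial segment of the block consists of
  the members up to a bound \<open>m\<close>.
\<close>

definition block_le :: "nat set \<Rightarrow> (nat \<Rightarrow> arrow) \<Rightarrow> (nat \<Rightarrow> arrow) \<Rightarrow> bool" where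
  "block_le B a b \<longleftrightarrow> (\<forall>m. card {r \<in> B. r \<le> m \<and> b r = LeftArrow} \<le> card {r \<in> B. r \<le> m \<and> a r = LeftArrow})"

lemma block_le_refl [simp]: "block_le B a a"
  by (simp add: block_le_def)

lemma block_le_trans: "block_le B a b \<Longrightarrow> block_le B b c \<Longrightarrow> block_le B a c"
  unfolding block_le_def using le_trans by blast

text \<open>
  The left arrow moves from \<open>j\<close> to the later position \<open>k\<close>. A segment reaching \<open>k\<close>
  contains it before and after the move; a segment reaching \<open>j\<close> but not \<open>k\<close> loses it.
\<close>

lemma block_le_swap:
  assumes "finite B" "j \<in> B" "k \<in> B" "j < k"
  shows "block_le B (h(k := RightArrow, j := LeftArrow)) (h(k := LeftArrow, j := RightArrow))"
  unfolding block_le_def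
proof
  fix m
  let ?X = "{r \<in> B. r \<le> m \<and> r \<noteq> j \<and> r \<noteq> k \<and> h r = LeftArrow}"
  let ?L = "\<lambda>a. {r \<in> B. r \<le> m \<and> a r = LeftArrow}"
  show "card (?L (h(k := LeftArrow, j := RightArrow))) \<le> card (?L (h(k := RightArrow, j := LeftArrow)))"
  proof (cases "k \<le> m")
    case True
    then have "?L (h(k := LeftArrow, j := RightArrow)) = insert k ?X"
      "?L (h(k := RightArrow, j := LeftArrow)) = insert j ?X"
      using assms by (auto split: if_splits)
    then show ?thesis using \<open>finite B\<close> by simp
  next
    case False
    then have "?L (h(k := LeftArrow, j := RightArrow)) \<subseteq> ?L (h(k := RightArrow, j := LeftArrow))"
      by (auto split: if_splits)
    then show ?thesis using \<open>finite B\<close> by (intro card_mono) auto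
  qed
qed

text \<open>
  The weight \<open>t\<close> of the sure right arrow solves \<open>q = t + (1 - t) p\<close>.
\<close>

lemma arrow_pmf_mixture:
  assumes "0 \<le> p" "p \<le> q" "q \<le> 1"
  obtains Z where "arrow_pmf q = bind_pmf Z (\<lambda>z. if z then return_pmf RightArrow else arrow_pmf p)"
proof
  \<comment> \<open>For \<open>p = 1\<close> also \<open>q = 1\<close>, and the default value \<open>t = 0\<close> of the quotient is correct.\<close>
  define t where "t = (q - p) / (1 - p)"
  have t: "0 \<le> t" "t \<le> 1" "t + p * (1 - t) = q"
  proof -
    have "0 \<le> t \<and> t \<le> 1 \<and> t + p * (1 - t) = q"
    proof (cases "p = 1")
      case False
      then have p: "p < 1" using assms by simp
      then have "t * (1 - p) = q - p" by (simp add: t_def)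
      then have "t + p * (1 - t) = q" by (simp add: algebra_simps)
      then show ?thesis using assms p by (simp add: t_def)
    qed (use assms in \<open>auto simp: t_def\<close>)
    then show "0 \<le> t" "t \<le> 1" "t + p * (1 - t) = q" by simp_all
  qed
  show "arrow_pmf q = bind_pmf (bernoulli_pmf t) (\<lambda>z. if z then return_pmf RightArrow else arrow_pmf p)"
  proof (rule pmf_eqI)
    fix c
    show "pmf (arrow_pmf q) c
      = pmf (bind_pmf (bernoulli_pmf t) (\<lambda>z. if z then return_pmf RightArrow else arrow_pmf p)) c"
      using assms t by (cases c) (auto simp: pmf_bind pmf_arrow_pmf algebra_simps)
  qed
qed

text \<open>
  Write the arrow of probability \<open>q\<close> as a mixture and use the same choice \<open>z\<close> of the component
  in both pairs. If it is the sure right arrow, the coupled pairs are \<open>(x, RightArrow)\<close> and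
  \<open>(RightArrow, x)\<close> with the same \<open>x\<close>; otherwise both pairs are independent with common
  probability \<open>p\<close>, and the same pair is used.
\<close>

lemma rel_pmf_favourable_pair:
  assumes "0 \<le> p" "p \<le> q" "q \<le> 1"
  shows "rel_pmf (\<lambda>v w. v = w \<or> v = (LeftArrow, RightArrow) \<and> w = (RightArrow, LeftArrow))
    (pair_pmf (arrow_pmf p) (arrow_pmf q)) (pair_pmf (arrow_pmf q) (arrow_pmf p))"
proof -
  obtain Z where Z: "arrow_pmf q = bind_pmf Z (\<lambda>z. if z then return_pmf RightArrow else arrow_pmf p)"
    using arrow_pmf_mixture[OF assms] .
  let ?P = "arrow_pmf p"
  have 1: "pair_pmf ?P (arrow_pmf q)
      = bind_pmf Z (\<lambda>z. if z then map_pmf (\<lambda>x. (x, RightArrow)) ?P else pair_pmf ?P ?P)"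
    unfolding Z pair_pmf_def map_pmf_def
    by (subst bind_assoc_pmf, subst bind_commute_pmf)
      (intro bind_pmf_cong refl, simp add: bind_return_pmf)
  have 2: "pair_pmf (arrow_pmf q) ?P
      = bind_pmf Z (\<lambda>z. if z then map_pmf (\<lambda>x. (RightArrow, x)) ?P else pair_pmf ?P ?P)"
    unfolding Z pair_pmf_def map_pmf_def
    by (subst bind_assoc_pmf) (intro bind_pmf_cong refl, simp add: bind_return_pmf)
  show ?thesis
    unfolding 1 2
  proof (rule rel_pmf_bindI[where R = "(=)"])
    show "rel_pmf (=) Z Z" by (simp add: pmf.rel_eq)
  next
    fix z z' :: bool assume "z = z'"
    have not_left: "x \<noteq> LeftArrow \<longleftrightarrow> x = RightArrow" for x by (cases x) auto
    show "rel_pmf (\<lambda>v w. v = w \<or> v = (LeftArrow, RightArrow) \<and> w = (RightArrow, LeftArrow))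
       (if z then map_pmf (\<lambda>x. (x, RightArrow)) ?P else pair_pmf ?P ?P)
       (if z' then map_pmf (\<lambda>x. (RightArrow, x)) ?P else pair_pmf ?P ?P)"
      unfolding \<open>z = z'\<close> by (auto simp: pmf.rel_map not_left intro!: rel_pmf_reflI)
  qed
qed

lemma block_pmf_insert2:
  assumes "finite B" "j \<notin> B" "k \<notin> B" "j \<noteq> k"
  shows "block_pmf (insert j (insert k B)) f =
     bind_pmf (pair_pmf (arrow_pmf (f j)) (arrow_pmf (f k)))
       (\<lambda>(x, y). map_pmf (\<lambda>h. h(k := y, j := x)) (block_pmf B f))"
  unfolding block_pmf_def using assms
  by (simp add: Pi_pmf_insert' pair_pmf_def map_pmf_def bind_assoc_pmf bind_return_pmf)

text \<open>
  The arrows off the two swapped positions have the same law in both environments, so they are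
  shared, and the coupling of pairs is applied at the two positions.
\<close>

lemma rel_pmf_favourable_swap:
  assumes B: "finite B" and f: "\<And>r. r \<in> B \<Longrightarrow> 0 \<le> f r \<and> f r \<le> 1"
    and swap: "favourable_swap B f g"
  shows "rel_pmf (block_le B) (block_pmf B f) (block_pmf B g)"
proof -
  obtain j k where jk: "j \<in> B" "k \<in> B" "j \<le> k" "f j \<le> f k" and g: "g = f(j := f k, k := f j)"
    using swap unfolding favourable_swap_def by blast
  show ?thesis
  proof (cases "j = k")
    case True
    then have "g = f" using g by simp
    then show ?thesis by (auto intro: rel_pmf_reflI)
  next
    case False
    define B' where "B' = B - {j, k}"
    have B': "finite B'" "j \<notin> B'" "k \<notin> B'" "B = insert j (insert k B')"
      using B jk by (auto simp: B'_def)
    have rest: "block_pmf B' g = block_pmf B' f"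
      unfolding block_pmf_def by (rule Pi_pmf_cong) (auto simp: g B'_def)
    have gjk: "g j = f k" "g k = f j" using False by (auto simp: g)
    note ins = block_pmf_insert2[OF B'(1-3) False, folded B'(4)]
    show ?thesis
      unfolding ins gjk rest
    proof (rule rel_pmf_bindI[OF rel_pmf_favourable_pair])
      fix v w assume vw: "v = w \<or> v = (LeftArrow, RightArrow) \<and> w = (RightArrow, LeftArrow)"
      have "block_le B (h(k := snd v, j := fst v)) (h(k := snd w, j := fst w))" for h
        using vw block_le_swap[OF B jk(1,2), of h] jk(3) False by auto
      then show "rel_pmf (block_le B)
         (case v of (x, y) \<Rightarrow> map_pmf (\<lambda>h. h(k := y, j := x)) (block_pmf B' f))
         (case w of (x, y) \<Rightarrow> map_pmf (\<lambda>h. h(k := y, j := x)) (block_pmf B' f))"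
        by (auto simp: case_prod_unfold pmf.rel_map intro!: rel_pmf_reflI)
    qed (use f jk in auto)
  qed
qed

text \<open>
  The couplings of consecutive swaps are composed along their common middle law. Swaps rearrange the
  values on the block, so all intermediate environments consist of probabilities.
\<close>

lemma rel_pmf_favourable_swaps:
  assumes B: "finite B" and swaps: "(favourable_swap B)\<^sup>*\<^sup>* f g"
    and f: "\<And>r. r \<in> B \<Longrightarrow> 0 \<le> f r \<and> f r \<le> 1"
  shows "rel_pmf (block_le B) (block_pmf B f) (block_pmf B g)"
  using swaps f
proof (induction rule: converse_rtranclp_induct)
  case base
  show ?case by (auto intro: rel_pmf_reflI)
next
  case (step f f')
  have "\<And>r. r \<in> B \<Longrightarrow> 0 \<le> f' r \<and> f' r \<le> 1"
    using step.hyps(1) step.prems unfolding favourable_swap_def by (auto split: if_splits)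
  from step.IH[OF this] rel_pmf_favourable_swap[OF B step.prems step.hyps(1)]
  have "rel_pmf (block_le B OO block_le B) (block_pmf B f) (block_pmf B g)"
    by (auto simp: pmf.rel_compp)
  then show ?case
    by (rule pmf.rel_mono_strong) (auto intro: block_le_trans)
qed

section \<open>Gluing the blocks\<close>

definition block_of :: "block_family \<Rightarrow> int \<Rightarrow> nat \<Rightarrow> nat" where
  "block_of A x r = (THE s. 1 \<le> s \<and> r \<in> A x s)"

lemma block_of_eq:
  assumes "partition_family A" "1 \<le> s" "r \<in> A x s"
  shows "block_of A x r = s"
  unfolding block_of_def
  using assms by (intro the_equality) (auto simp: partition_family_def disjoint_family_on_def)

lemma mem_block_of:
  assumes "partition_family A" "1 \<le> r"
  shows "1 \<le> block_of A x r" "r \<in> A x (block_of A x r)"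
proof -
  have "r \<in> (\<Union>s\<in>{1..}. A x s)" using assms by (simp add: partition_family_def)
  then obtain s where "1 \<le> s" "r \<in> A x s" by auto
  with block_of_eq[OF assms(1) this]
  show "1 \<le> block_of A x r" "r \<in> A x (block_of A x r)" by simp_all
qed

lemma block_pos:
  assumes "partition_family A" "1 \<le> s" "r \<in> A x s"
  shows "1 \<le> r"
proof -
  have "r \<in> (\<Union>s\<in>{1..}. A x s)" using assms(2,3) by auto
  then show ?thesis using assms(1) by (auto simp: partition_family_def)
qed

text \<open>
  Each block comes with its own configuration of arrows; the arrow at \<open>(x, r)\<close> is read off the
  configuration of the block that contains \<open>r\<close>.
\<close>

definition glue :: "block_family \<Rightarrow> (int \<Rightarrow> nat \<Rightarrow> nat \<Rightarrow> arrow) \<Rightarrow> arrow_system" where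
  "glue A a x r = a x (block_of A x r) r"

lemma left_arrows_glue:
  assumes A: "partition_family A"
  shows "left_arrows (glue A a) x m =
    (\<Sum>s\<in>block_of A x ` {1..m}. card {r \<in> A x s. r \<le> m \<and> a x s r = LeftArrow})"
proof -
  let ?K = "block_of A x ` {1..m}"
  have K: "1 \<le> s" if "s \<in> ?K" for s
    using that mem_block_of[OF A] by auto
  have "{r \<in> {1..m}. glue A a x r = LeftArrow}
      = (\<Union>s\<in>?K. {r \<in> A x s. r \<le> m \<and> a x s r = LeftArrow})" (is "?L = ?R")
  proof (intro set_eqI iffI)
    fix r assume "r \<in> ?L"
    then show "r \<in> ?R" using mem_block_of[OF A, of r x]
      by (intro UN_I[of "block_of A x r"]) (auto simp: glue_def)
  next
    fix r assume "r \<in> ?R"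
    then obtain s where s: "s \<in> ?K" "r \<in> A x s" "r \<le> m" "a x s r = LeftArrow" by blast
    from K[OF s(1)] have "block_of A x r = s" "1 \<le> r"
      using block_of_eq[OF A _ s(2)] block_pos[OF A _ s(2)] by simp_all
    then show "r \<in> ?L" using s(3,4) by (simp add: glue_def)
  qed
  moreover have "card (\<Union>s\<in>?K. {r \<in> A x s. r \<le> m \<and> a x s r = LeftArrow})
      = (\<Sum>s\<in>?K. card {r \<in> A x s. r \<le> m \<and> a x s r = LeftArrow})"
  proof (rule card_UN_disjoint)
    show "\<forall>s\<in>?K. finite {r \<in> A x s. r \<le> m \<and> a x s r = LeftArrow}" by auto
    show "\<forall>s\<in>?K. \<forall>t\<in>?K. s \<noteq> t \<longrightarrow> {r \<in> A x s. r \<le> m \<and> a x s r = LeftArrow}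
        \<inter> {r \<in> A x t. r \<le> m \<and> a x t r = LeftArrow} = {}"
    proof (intro ballI impI)
      fix s t assume st: "s \<in> ?K" "t \<in> ?K" "s \<noteq> t"
      have "A x s \<inter> A x t = {}"
      proof (rule equals0I)
        fix r assume "r \<in> A x s \<inter> A x t"
        then show False
          using block_of_eq[OF A K[OF st(1)], of r x] block_of_eq[OF A K[OF st(2)], of r x] st(3) by simp
      qed
      then show "{r \<in> A x s. r \<le> m \<and> a x s r = LeftArrow}
        \<inter> {r \<in> A x t. r \<le> m \<and> a x t r = LeftArrow} = {}"
        by blast
    qed
  qed simp
  ultimately show ?thesis unfolding left_arrows_def by simp
qed

lemma arrow_system_le_glue:
  assumes A: "partition_family A" and le: "\<And>x s. 1 \<le> s \<Longrightarrow> block_le (A x s) (a x s) (b x s)"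
  shows "arrow_system_le (glue A a) (glue A b)"
  unfolding arrow_system_le_def left_arrows_glue[OF A]
proof (intro allI impI sum_mono)
  fix x m s assume "s \<in> block_of A x ` {1..m}"
  then have "1 \<le> s" using mem_block_of[OF A] by auto
  from le[OF this] show "card {r \<in> A x s. r \<le> m \<and> b x s r = LeftArrow}
      \<le> card {r \<in> A x s. r \<le> m \<and> a x s r = LeftArrow}"
    by (simp add: block_le_def)
qed

lemma measurable_glue_component:
  "(\<lambda>c. glue A (\<lambda>x s. \<phi> (c (x, s))) x r)
     \<in> (\<Pi>\<^sub>M k\<in>UNIV. measure_pmf (C k)) \<rightarrow>\<^sub>M count_space UNIV"
  unfolding glue_def
  by (rule measurable_compose[OF measurable_component_singleton[of "(x, block_of A x r)"]]) auto

text \<open>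
  Sorting the prescribed arrows \<open>J\<close> by block, the product measure factorises over the blocks that
  occur, and within a block the law of the configuration factorises over positions. The map \<open>\<phi>\<close>
  selects a component of a coupling, so the lemma serves both members of the pair of systems.
\<close>

lemma independent_arrows_glue:
  fixes C :: "int \<times> nat \<Rightarrow> 'b pmf" and \<phi> :: "'b \<Rightarrow> nat \<Rightarrow> arrow"
  assumes A: "partition_family A"
    and C: "\<And>x s. 1 \<le> s \<Longrightarrow> map_pmf \<phi> (C (x, s)) = block_pmf (A x s) (\<omega> x)"
  shows "independent_arrows (\<Pi>\<^sub>M k\<in>UNIV. measure_pmf (C k)) \<omega> (\<lambda>c. glue A (\<lambda>x s. \<phi> (c (x, s))))"
  unfolding independent_arrows_def
proof (intro conjI allI impI measurable_glue_component)
  fix J :: "(int \<times> nat) set" and \<A> assume J: "finite J" "J \<subseteq> UNIV \<times> {1..}"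
  interpret product_prob_space "\<lambda>k. measure_pmf (C k)" UNIV
    by (rule product_prob_spaceI) (rule measure_pmf.prob_space_axioms)
  let ?P = "\<Pi>\<^sub>M k\<in>UNIV. measure_pmf (C k)"
  let ?\<kappa> = "\<lambda>(x, r). (x, block_of A x r)"
  let ?p = "\<lambda>(x, r). pmf (arrow_pmf (\<omega> x r)) (\<A> x r)"
  define X where "X k = {h. \<forall>y r. (y, r) \<in> J \<and> (y, block_of A y r) = k \<longrightarrow> \<phi> h r = \<A> y r}" for k
  have one_block: "measure (C k) (X k) = prod ?p {i \<in> J. ?\<kappa> i = k}" if "k \<in> ?\<kappa> ` J" for k
  proof -
    obtain x s where k: "k = (x, s)" by (cases k)
    have s: "1 \<le> s" using that J(2) mem_block_of[OF A] by (auto simp: k)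
    have fin: "finite (A x s)" using A s by (simp add: partition_family_def)
    have mem: "(y, r) \<in> J \<and> (y, block_of A y r) = k \<longleftrightarrow> y = x \<and> r \<in> A x s \<and> (x, r) \<in> J" for y r
      using J(2) mem_block_of(2)[OF A, of r x] block_of_eq[OF A s, of r x] by (auto simp: k)
    let ?Y = "\<lambda>r. {c. (x, r) \<in> J \<longrightarrow> c = \<A> x r}"
    have "X k = \<phi> -` Pi (A x s) ?Y"
      unfolding X_def mem by (auto simp: Pi_iff)
    then have "measure (C k) (X k) = measure (map_pmf \<phi> (C (x, s))) (Pi (A x s) ?Y)"
      by (simp add: k)
    also have "\<dots> = (\<Prod>r\<in>A x s. measure (arrow_pmf (\<omega> x r)) (?Y r))"
      unfolding C[OF s] block_pmf_def by (rule measure_Pi_pmf_Pi[OF fin])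
    \<comment> \<open>Positions of the block outside \<open>J\<close> are unconstrained and contribute a factor \<open>1\<close>.\<close>
    also have "\<dots> = (\<Prod>r\<in>A x s. if (x, r) \<in> J then ?p (x, r) else 1)"
      by (intro prod.cong refl) (simp add: pmf.rep_eq)
    also have "\<dots> = (\<Prod>r\<in>{r \<in> A x s. (x, r) \<in> J}. ?p (x, r))"
      by (rule prod.inter_filter[OF fin, symmetric])
    also have "\<dots> = prod ?p {i \<in> J. ?\<kappa> i = k}"
    proof -
      have "{i \<in> J. ?\<kappa> i = k} = Pair x ` {r \<in> A x s. (x, r) \<in> J}"
      proof (rule set_eqI)
        fix i :: "int \<times> nat"
        obtain y r where i: "i = (y, r)" by (cases i)
        show "i \<in> {i \<in> J. ?\<kappa> i = k} \<longleftrightarrow> i \<in> Pair x ` {r \<in> A x s. (x, r) \<in> J}"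
          unfolding i mem_Collect_eq prod.case mem by blast
      qed
      then show ?thesis by (simp add: prod.reindex inj_on_def)
    qed
    finally show ?thesis .
  qed
  have "{c \<in> space ?P. \<forall>(x, r)\<in>J. glue A (\<lambda>x s. \<phi> (c (x, s))) x r = \<A> x r}
      = prod_emb UNIV (\<lambda>k. measure_pmf (C k)) (?\<kappa> ` J) (Pi\<^sub>E (?\<kappa> ` J) X)"
  proof (rule set_eqI)
    fix c
    have "(\<forall>(x, r)\<in>J. \<phi> (c (x, block_of A x r)) r = \<A> x r) \<longleftrightarrow> (\<forall>k\<in>?\<kappa> ` J. c k \<in> X k)"
    proof (intro iffI ballI)
      fix k assume "\<forall>(x, r)\<in>J. \<phi> (c (x, block_of A x r)) r = \<A> x r"
      then show "c k \<in> X k" unfolding X_def by auto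
    next
      fix i assume i: "i \<in> J" and all: "\<forall>k\<in>?\<kappa> ` J. c k \<in> X k"
      obtain x r where xr: "i = (x, r)" by (cases i)
      have "c (x, block_of A x r) \<in> X (x, block_of A x r)"
        using bspec[OF all imageI[OF i]] by (simp add: xr)
      then show "case i of (x, r) \<Rightarrow> \<phi> (c (x, block_of A x r)) r = \<A> x r"
        using i unfolding X_def xr by simp
    qed
    then show "c \<in> {c \<in> space ?P. \<forall>(x, r)\<in>J. glue A (\<lambda>x s. \<phi> (c (x, s))) x r = \<A> x r} \<longleftrightarrow>
        c \<in> prod_emb UNIV (\<lambda>k. measure_pmf (C k)) (?\<kappa> ` J) (Pi\<^sub>E (?\<kappa> ` J) X)"
      by (simp add: prod_emb_def space_PiM glue_def Pi_iff)
  qed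
  then have "measure ?P {c \<in> space ?P. \<forall>(x, r)\<in>J. glue A (\<lambda>x s. \<phi> (c (x, s))) x r = \<A> x r}
      = (\<Prod>k\<in>?\<kappa> ` J. measure (C k) (X k))"
    using J(1) by (simp add: measure_PiM_emb)
  also have "\<dots> = (\<Prod>k\<in>?\<kappa> ` J. prod ?p {i \<in> J. ?\<kappa> i = k})"
    by (rule prod.cong) (auto simp: one_block)
  also have "\<dots> = prod ?p J"
    by (rule prod.image_gen[OF J(1), symmetric])
  finally show "measure ?P {c \<in> space ?P. \<forall>(x, r)\<in>J. glue A (\<lambda>x s. \<phi> (c (x, s))) x r = \<A> x r} = prod ?p J" .
qed

text \<open>
  With the product \<open>\<sigma>\<close>-algebra both reading a single arrow and gluing blocks are measurable, the
  latter because it can be checked arrow by arrow.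
\<close>

definition arrow_space :: "arrow_system measure" where
  "arrow_space = (\<Pi>\<^sub>M x\<in>UNIV. \<Pi>\<^sub>M r\<in>UNIV. count_space UNIV)"

lemma space_arrow_space [simp]: "space arrow_space = UNIV"
  by (simp add: arrow_space_def space_PiM)

lemma measurable_arrow_space_component [measurable]:
  "(\<lambda>\<E>. \<E> x r) \<in> arrow_space \<rightarrow>\<^sub>M count_space UNIV"
  unfolding arrow_space_def
  by (rule measurable_compose[OF measurable_component_singleton[of x] measurable_component_singleton[of r]]) simp_all

lemma measurable_arrow_spaceI:
  assumes "\<And>x r. (\<lambda>u. a u x r) \<in> M \<rightarrow>\<^sub>M count_space UNIV"
  shows "a \<in> M \<rightarrow>\<^sub>M arrow_space"
proof -
  have "(\<lambda>u x r. a u x r) \<in> M \<rightarrow>\<^sub>M arrow_space"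
    unfolding arrow_space_def by (intro measurable_abs_UNIV assms)
  then show ?thesis by simp
qed

lemma measurable_left_arrows [measurable]:
  "(\<lambda>\<E>. left_arrows \<E> x r) \<in> borel_measurable arrow_space"
proof -
  have "left_arrows \<E> x r = (\<Sum>i\<in>{1..r}. if \<E> x i = LeftArrow then 1 else 0)" for \<E>
    unfolding left_arrows_def by (simp add: sum.If_cases Int_def)
  then show ?thesis by simp
qed

theorem theorem5p2:
  fixes A :: block_family and \<omega> \<omega>' :: environment
  assumes "partition_family A"
    and "cookie_environment \<omega>" and "cookie_environment \<omega>'"
    and "environment_le A \<omega> \<omega>'"
  shows "\<exists>(M :: (arrow_system \<times> arrow_system) measure) E E'.
           prob_space M \<and>
           excited_random_walk M \<omega> E \<and> excited_random_walk M \<omega>' E' \<and>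
           (AE u in M. sequence_le (\<lambda>n. E n u) (\<lambda>n. E' n u))"
proof -
  note A = assms(1)
  let ?Q = "\<lambda>x s c. 1 \<le> s \<longrightarrow> map_pmf fst c = block_pmf (A x s) (\<omega> x) \<and>
      map_pmf snd c = block_pmf (A x s) (\<omega>' x) \<and> (\<forall>(a, b)\<in>set_pmf c. block_le (A x s) a b)"
  have block_coupling: "\<exists>c. ?Q x s c" for x s
  proof (cases "1 \<le> s")
    case True
    have "rel_pmf (block_le (A x s)) (block_pmf (A x s) (restrict (\<omega> x) (A x s)))
        (block_pmf (A x s) (restrict (\<omega>' x) (A x s)))"
    proof (rule rel_pmf_favourable_swaps)
      show "finite (A x s)" using A True by (simp add: partition_family_def)
      show "(favourable_swap (A x s))\<^sup>*\<^sup>* (restrict (\<omega> x) (A x s)) (restrict (\<omega>' x) (A x s))"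
        using assms(4) True by (simp add: environment_le_def)
      show "0 \<le> restrict (\<omega> x) (A x s) r \<and> restrict (\<omega> x) (A x s) r \<le> 1" if "r \<in> A x s" for r
        using assms(2) that block_pos[OF A True that] by (simp add: cookie_environment_def)
    qed
    then show ?thesis
      unfolding block_pmf_restrict pmf.in_rel by (auto simp: subset_iff)
  qed simp
  obtain C where C: "\<And>x s. 1 \<le> s \<Longrightarrow> map_pmf fst (C (x, s)) = block_pmf (A x s) (\<omega> x)"
    "\<And>x s. 1 \<le> s \<Longrightarrow> map_pmf snd (C (x, s)) = block_pmf (A x s) (\<omega>' x)"
    "\<And>x s a b. 1 \<le> s \<Longrightarrow> (a, b) \<in> set_pmf (C (x, s)) \<Longrightarrow> block_le (A x s) a b"
  proof -
    have "\<forall>k. \<exists>c. ?Q (fst k) (snd k) c" using block_coupling by blast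
    from choice[OF this] obtain C where C: "\<forall>k. ?Q (fst k) (snd k) (C k)" ..
    show thesis
    proof (rule that)
      fix x s assume s: "1 \<le> (s :: nat)"
      note Cxs = C[rule_format, of "(x, s)", simplified, OF s[simplified]]
      show "map_pmf fst (C (x, s)) = block_pmf (A x s) (\<omega> x)"
        "map_pmf snd (C (x, s)) = block_pmf (A x s) (\<omega>' x)"
        using Cxs by simp_all
      fix a b assume "(a, b) \<in> set_pmf (C (x, s))"
      then show "block_le (A x s) a b" using Cxs by auto
    qed
  qed
  let ?P = "\<Pi>\<^sub>M k\<in>UNIV. measure_pmf (C k)"
  let ?a = "\<lambda>c. glue A (\<lambda>x s. fst (c (x, s)))" and ?b = "\<lambda>c. glue A (\<lambda>x s. snd (c (x, s)))"
  let ?T = "\<lambda>c. (?a c, ?b c)"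
  let ?N = "arrow_space \<Otimes>\<^sub>M arrow_space"
  define M where "M = distr ?P ?N ?T"
  interpret P: product_prob_space "\<lambda>k. measure_pmf (C k)" UNIV
    by (rule product_prob_spaceI) (rule measure_pmf.prob_space_axioms)
  have T: "?T \<in> ?P \<rightarrow>\<^sub>M ?N"
    by (intro measurable_Pair measurable_arrow_spaceI measurable_glue_component)
  have M: "prob_space M"
    unfolding M_def by (rule P.prob_space_distr[OF T])
  have "independent_arrows M \<omega> fst" "independent_arrows M \<omega>' snd"
    unfolding M_def
    by (rule independent_arrows_distr[OF T]; simp add: independent_arrows_glue[OF A] C(1,2))+
  then have walks: "excited_random_walk M \<omega> (\<lambda>n u. arrow_walk (fst u) n)"
    "excited_random_walk M \<omega>' (\<lambda>n u. arrow_walk (snd u) n)"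
    using excited_random_walk_arrow_walk[OF M] assms(2,3) by auto
  have "AE c in ?P. \<forall>x s. 1 \<le> s \<longrightarrow> block_le (A x s) (fst (c (x, s))) (snd (c (x, s)))"
    unfolding AE_all_countable
  proof (intro allI)
    fix x s
    have "AE v in C (x, s). 1 \<le> s \<longrightarrow> block_le (A x s) (fst v) (snd v)"
      using C(3) by (auto simp: AE_measure_pmf_iff)
    then show "AE c in ?P. 1 \<le> s \<longrightarrow> block_le (A x s) (fst (c (x, s))) (snd (c (x, s)))"
      by (rule P.AE_component[OF UNIV_I])
  qed
  then have "AE c in ?P. arrow_system_le (?a c) (?b c)"
    by eventually_elim (auto intro: arrow_system_le_glue[OF A])
  moreover have "{u \<in> space ?N. arrow_system_le (fst u) (snd u)} \<in> sets ?N"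
  proof -
    have "{u \<in> space ?N. left_arrows (snd u) j r \<le> left_arrows (fst u) j r} \<in> sets ?N" for j r
      by (intro borel_measurable_le measurable_compose[OF measurable_fst measurable_left_arrows]
          measurable_compose[OF measurable_snd measurable_left_arrows])
    then show ?thesis
      unfolding arrow_system_le_def
      by (intro sets.sets_Collect_countable_All sets.sets_Collect_imp sets.sets_Collect_const)
  qed
  ultimately have "AE u in M. arrow_system_le (fst u) (snd u)"
    unfolding M_def by (subst AE_distr_iff[OF T]) auto
  then have "AE u in M. sequence_le (\<lambda>n. arrow_walk (fst u) n) (\<lambda>n. arrow_walk (snd u) n)"
    by eventually_elim (auto simp: sequence_le_def)
  with M walks show ?thesis by blast
qed

end
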